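(* The transition system space $\mathrm{PA}^*_{01}$ is less expressive than the transition system space $\bigcup_\gamma \mathrm{ACP}^*_{01}$ (the disjoint union of the spaces $\mathrm{ACP}^*_{01}$ over all communication functions $\gamma$ on $A$): every $\mathrm{PA}^*_{01}$ expression is bisimilar to some state of $\bigcup_\gamma\mathrm{ACP}^*_{01}$, and some state of $\bigcup_\gamma\mathrm{ACP}^*_{01}$ is not bisimilar to any $\mathrm{PA}^*_{01}$ expression.
   Context: Fix a non-empty set $A$ of actions. A communication function is an associative and commutative partial binary operation $\gamma: A\times A\rightharpoonup A$. $\mathrm{ACP}^*_{01}$ expressions are generated by $p ::= \mathbf{0} \mid \mathbf{1} \mid a \mid p\cdot p \mid p+p \mid p^* \mid p\parallel p \mid \partial_H(p)$ with $a\in A$, $H\subseteq A$; $\mathrm{PA}^*_{01}$ expressions are those without $\partial_H$. For a given $\gamma$, the transition relation $p\xrightarrow{a}p'$ and termination predicate $p\downarrow$ of $\mathrm{ACP}^*_{01}$ are the least relations such that: $\mathbf{1}\downarrow$; $a\xrightarrow{a}\mathbf{1}$; if $p\xrightarrow{a}p'$ then $p+q\xrightarrow{a}p'$ and $q+p\xrightarrow{a}p'$; if $p\downarrow$ then $(p+q)\downarrow$ and $(q+p)\downarrow$; if $p\xrightarrow{a}p'$ then $p\cdot q\xrightarrow{a}p'\cdot q$; if $p\downarrow$ and $q\xrightarrow{a}q'$ then $p\cdot q\xrightarrow{a}q'$; if $p\downarrow$ and $q\downarrow$ then $(p\cdot q)\downarrow$; if $p\xrightarrow{a}p'$ then $p^*\xrightarrow{a}p'\cdot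 p^*$; $p^*\downarrow$; if $p\xrightarrow{a}p'$ then $p\parallel q\xrightarrow{a}p'\parallel q$; if $q\xrightarrow{a}q'$ then $p\parallel q\xrightarrow{a}p\parallel q'$; if $p\downarrow$ and $q\downarrow$ then $(p\parallel q)\downarrow$; if $p\xrightarrow{a}p'$, $q\xrightarrow{b}q'$ and $\gamma(a,b)$ is defined then $p\parallel q\xrightarrow{\gamma(a,b)}p'\parallel q'$; if $p\xrightarrow{a}p'$ and $a\notin H$ then $\partial_H(p)\xrightarrow{a}\partial_H(p')$; if $p\downarrow$ then $\partial_H(p)\downarrow$. The transition system space $\mathrm{PA}^*_{01}$ consists of the $\mathrm{PA}^*_{01}$ expressions with the relations obtained from all rules except the communication and encapsulation rules (equivalently, with $\gamma$ everywhere undefined). A bisimulation between transition system spaces $(S_1,\to_1,\downarrow_1)$ and $(S_2,\to_2,\downarrow_2)$ is a relation $R\subseteq S_1\times S_2$ such that whenever $s_1 R s_2$: each $s_1\xrightarrow{a}_1 s_1'$ is matched by some $s_2\xrightarrow{a}_2 s_2'$ with $s_1' R s_2'$; symmetrically for $s_2$; and $s_1\downarrow_1$ iff $s_2\downarrow_2$. States are bisimilar if related by some bisimulation. $T_1$ is less expressive than $T_2$ if every state of $T_1$ is bisimilar to a state of $T_2$ and some state of $T_2$ is bisimilar to no state of $T_1$. *)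

theory Defs
  imports Main
begin

record ('s, 'a) tss =
  states :: "'s set"
  step :: "'s \<Rightarrow> 'a \<Rightarrow> 's \<Rightarrow> bool"
  final :: "'s \<Rightarrow> bool"

definition bisimulation ::
    "('s, 'a) tss \<Rightarrow> ('t, 'a) tss \<Rightarrow> ('s \<Rightarrow> 't \<Rightarrow> bool) \<Rightarrow> bool" where
  "bisimulation T1 T2 R \<longleftrightarrow>
     (\<forall>s1 s2. R s1 s2 \<longrightarrow>
        s1 \<in> states T1 \<and> s2 \<in> states T2 \<and>
        (\<forall>a s1'. step T1 s1 a s1' \<longrightarrow> (\<exists>s2'. step T2 s2 a s2' \<and> R s1' s2')) \<and>
        (\<forall>a s2'. step T2 s2 a s2' \<longrightarrow> (\<exists>s1'. step T1 s1 a s1' \<and> R s1' s2')) \<and>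
        (final T1 s1 \<longleftrightarrow> final T2 s2))"

definition bisimilar ::
    "('s, 'a) tss \<Rightarrow> ('t, 'a) tss \<Rightarrow> 's \<Rightarrow> 't \<Rightarrow> bool" where
  "bisimilar T1 T2 s1 s2 \<longleftrightarrow> (\<exists>R. bisimulation T1 T2 R \<and> R s1 s2)"

definition less_expressive :: "('s, 'a) tss \<Rightarrow> ('t, 'a) tss \<Rightarrow> bool" where
  "less_expressive T1 T2 \<longleftrightarrow>
     (\<forall>s1 \<in> states T1. \<exists>s2 \<in> states T2. bisimilar T1 T2 s1 s2) \<and>
     (\<exists>s2 \<in> states T2. \<not> (\<exists>s1 \<in> states T1. bisimilar T1 T2 s1 s2))"

definition disjoint_union :: "'i set \<Rightarrow> ('i \<Rightarrow> ('s, 'a) tss) \<Rightarrow> ('i \<times> 's, 'a) tss" where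
  "disjoint_union I T =
     \<lparr> states = (SIGMA i:I. states (T i)),
       step = (\<lambda>(i, s) a (j, s'). j = i \<and> step (T i) s a s'),
       final = (\<lambda>(i, s). final (T i) s) \<rparr>"

text \<open>
  The non-empty set of actions is the type \<open>'a\<close>. Partial operations have values in
  \<open>'a option\<close>, and associativity is strong equality: either both sides are undefined, or both
  are defined and equal.
\<close>

definition communication_function :: "('a \<Rightarrow> 'a \<Rightarrow> 'a option) \<Rightarrow> bool" where
  "communication_function \<gamma> \<longleftrightarrow>
     (\<forall>a b. \<gamma> a b = \<gamma> b a) \<and>
     (\<forall>a b c. Option.bind (\<gamma> a b) (\<lambda>d. \<gamma> d c) = Option.bind (\<gamma> b c) (\<lambda>d. \<gamma> a d))"

datatype 'a exp =
    Zero
  | One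
  | Act 'a
  | Seq "'a exp" "'a exp"
  | Alt "'a exp" "'a exp"
  | Star "'a exp"
  | Par "'a exp" "'a exp"
  | Encap "'a set" "'a exp"

inductive acp_final :: "'a exp \<Rightarrow> bool" where
  One: "acp_final One"
| AltL: "acp_final p \<Longrightarrow> acp_final (Alt p q)"
| AltR: "acp_final p \<Longrightarrow> acp_final (Alt q p)"
| Seq: "acp_final p \<Longrightarrow> acp_final q \<Longrightarrow> acp_final (Seq p q)"
| Star: "acp_final (Star p)"
| Par: "acp_final p \<Longrightarrow> acp_final q \<Longrightarrow> acp_final (Par p q)"
| Encap: "acp_final p \<Longrightarrow> acp_final (Encap H p)"

inductive acp_step :: "('a \<Rightarrow> 'a \<Rightarrow> 'a option) \<Rightarrow> 'a exp \<Rightarrow> 'a \<Rightarrow> 'a exp \<Rightarrow> bool"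
  for \<gamma> :: "'a \<Rightarrow> 'a \<Rightarrow> 'a option" where
  Act: "acp_step \<gamma> (Act a) a One"
| AltL: "acp_step \<gamma> p a p' \<Longrightarrow> acp_step \<gamma> (Alt p q) a p'"
| AltR: "acp_step \<gamma> p a p' \<Longrightarrow> acp_step \<gamma> (Alt q p) a p'"
| SeqL: "acp_step \<gamma> p a p' \<Longrightarrow> acp_step \<gamma> (Seq p q) a (Seq p' q)"
| SeqR: "acp_final p \<Longrightarrow> acp_step \<gamma> q a q' \<Longrightarrow> acp_step \<gamma> (Seq p q) a q'"
| Star: "acp_step \<gamma> p a p' \<Longrightarrow> acp_step \<gamma> (Star p) a (Seq p' (Star p))"
| ParL: "acp_step \<gamma> p a p' \<Longrightarrow> acp_step \<gamma> (Par p q) a (Par p' q)"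
| ParR: "acp_step \<gamma> q a q' \<Longrightarrow> acp_step \<gamma> (Par p q) a (Par p q')"
| Comm: "acp_step \<gamma> p a p' \<Longrightarrow> acp_step \<gamma> q b q' \<Longrightarrow> \<gamma> a b = Some c \<Longrightarrow>
    acp_step \<gamma> (Par p q) c (Par p' q')"
| Encap: "acp_step \<gamma> p a p' \<Longrightarrow> a \<notin> H \<Longrightarrow> acp_step \<gamma> (Encap H p) a (Encap H p')"

definition ACP :: "('a \<Rightarrow> 'a \<Rightarrow> 'a option) \<Rightarrow> ('a exp, 'a) tss" where
  "ACP \<gamma> = \<lparr> states = UNIV, step = acp_step \<gamma>, final = acp_final \<rparr>"

primrec encap_free :: "'a exp \<Rightarrow> bool" where
  "encap_free Zero \<longleftrightarrow> True"
| "encap_free One \<longleftrightarrow> True"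
| "encap_free (Act a) \<longleftrightarrow> True"
| "encap_free (Seq p q) \<longleftrightarrow> encap_free p \<and> encap_free q"
| "encap_free (Alt p q) \<longleftrightarrow> encap_free p \<and> encap_free q"
| "encap_free (Star p) \<longleftrightarrow> encap_free p"
| "encap_free (Par p q) \<longleftrightarrow> encap_free p \<and> encap_free q"
| "encap_free (Encap H p) \<longleftrightarrow> False"

inductive pa_final :: "'a exp \<Rightarrow> bool" where
  One: "pa_final One"
| AltL: "pa_final p \<Longrightarrow> pa_final (Alt p q)"
| AltR: "pa_final p \<Longrightarrow> pa_final (Alt q p)"
| Seq: "pa_final p \<Longrightarrow> pa_final q \<Longrightarrow> pa_final (Seq p q)"
| Star: "pa_final (Star p)"
| Par: "pa_final p \<Longrightarrow> pa_final q \<Longrightarrow> pa_final (Par p q)"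

inductive pa_step :: "'a exp \<Rightarrow> 'a \<Rightarrow> 'a exp \<Rightarrow> bool" where
  Act: "pa_step (Act a) a One"
| AltL: "pa_step p a p' \<Longrightarrow> pa_step (Alt p q) a p'"
| AltR: "pa_step p a p' \<Longrightarrow> pa_step (Alt q p) a p'"
| SeqL: "pa_step p a p' \<Longrightarrow> pa_step (Seq p q) a (Seq p' q)"
| SeqR: "pa_final p \<Longrightarrow> pa_step q a q' \<Longrightarrow> pa_step (Seq p q) a q'"
| Star: "pa_step p a p' \<Longrightarrow> pa_step (Star p) a (Seq p' (Star p))"
| ParL: "pa_step p a p' \<Longrightarrow> pa_step (Par p q) a (Par p' q)"
| ParR: "pa_step q a q' \<Longrightarrow> pa_step (Par p q) a (Par p q')"

definition PA :: "('a exp, 'a) tss" where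
  "PA = \<lparr> states = {p. encap_free p}, step = pa_step, final = pa_final \<rparr>"

text \<open>
  The relations \<open>pa_step\<close> and \<open>pa_final\<close> are defined on all expressions; the following facts show
  that \<open>PA\<close> is closed under transitions and that its relations are those of \<open>ACP\<close> with the
  nowhere defined communication function.
\<close>

lemma pa_step_encap_free: "pa_step p a p' \<Longrightarrow> encap_free p \<Longrightarrow> encap_free p'"
  by (induction rule: pa_step.induct) auto

lemma pa_final_iff: "encap_free p \<Longrightarrow> pa_final p \<longleftrightarrow> acp_final p"
proof
  show "pa_final p \<Longrightarrow> acp_final p"
    by (induction rule: pa_final.induct) (auto intro: acp_final.intros)
  show "acp_final p \<Longrightarrow> encap_free p \<Longrightarrow> pa_final p"
    by (induction rule: acp_final.induct) (auto intro: pa_final.intros)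
qed

lemma pa_step_iff:
  "encap_free p \<Longrightarrow> pa_step p a p' \<longleftrightarrow> acp_step (\<lambda>_ _. None) p a p'"
proof
  show "pa_step p a p' \<Longrightarrow> encap_free p \<Longrightarrow> acp_step (\<lambda>_ _. None) p a p'"
    by (induction rule: pa_step.induct) (auto intro: acp_step.intros simp: pa_final_iff)
  show "acp_step (\<lambda>_ _. None) p a p' \<Longrightarrow> encap_free p \<Longrightarrow> pa_step p a p'"
    by (induction rule: acp_step.induct) (auto intro: pa_step.intros simp: pa_final_iff)
qed

end

theory Submission
  imports Defs
begin

text \<open>
  Fix an action \<open>a\<close> and let \<open>a\<close> communicate with itself to \<open>a\<close>. The separating process is
  \<open>X = S \<parallel> (a + 1)\<close>, where \<open>S = (a\<cdot>a)\<^sup>*\<cdot>a\<close>. Let \<open>M\<close> be the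
  intermediate state of the loop of \<open>S\<close>, and \<open>Y = M \<parallel> (a + 1)\<close>. The state \<open>X\<close> is not
  final and can move to \<open>1\<close> (by a communication), to \<open>a + 1\<close>, and to \<open>Y\<close>; the state \<open>Y\<close> can
  move to \<open>X\<close> and to \<open>M\<close>, but to no final state.

  By structural induction, no \<open>PA\<close> expression \<open>p\<close> reaches, in at least one step, a state
  bisimilar to \<open>X\<close>. In \<open>r \<parallel> u\<close> only one component moves at a time, so a step to \<open>1\<close> means that
  the other component already is \<open>1\<close> and can be removed. The derivatives of an iteration that has
  a transition never step to \<open>1\<close>. In a sequential composition \<open>r\<cdot>q\<close> with \<open>q\<close> final, the step to
  \<open>1\<close> forces \<open>q\<close> to be \<open>1\<close>, which can be removed. If \<open>q\<close> is not final, then the step to \<open>a + 1\<close>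
  comes from \<open>q\<close>; then \<open>M\<close> must be of the form \<open>r'\<cdot>q\<close> as well, and, in order to terminate, it must
  pass through a state that steps to \<open>a + 1\<close>, which is impossible.
\<close>

section \<open>Communication functions and inversion of the operational rules\<close>

definition self_comm :: "'a \<Rightarrow> 'a \<Rightarrow> 'a \<Rightarrow> 'a option" where
  "self_comm a b c = (if b = a \<and> c = a then Some a else None)"

lemma communication_function_self_comm: "communication_function (self_comm a)"
  by (auto simp: communication_function_def self_comm_def)

lemma communication_function_None: "communication_function (\<lambda>_ _. None)"
  by (simp add: communication_function_def)

lemma acp_final_simps [simp]:
  "\<not> acp_final Zero"
  "acp_final One"
  "\<not> acp_final (Act a)"
  "acp_final (Alt p q) \<longleftrightarrow> acp_final p \<or> acp_final q"
  "acp_final (Seq p q) \<longleftrightarrow> acp_final p \<and> acp_final q"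
  "acp_final (Star p)"
  "acp_final (Par p q) \<longleftrightarrow> acp_final p \<and> acp_final q"
  by (auto elim: acp_final.cases intro: acp_final.intros)

lemma acp_step_simps [simp]:
  "\<not> acp_step \<gamma> One b r"
  "acp_step \<gamma> (Act a) b r \<longleftrightarrow> b = a \<and> r = One"
  "acp_step \<gamma> (Alt p q) b r \<longleftrightarrow> acp_step \<gamma> p b r \<or> acp_step \<gamma> q b r"
  "acp_step \<gamma> (Seq p q) b r \<longleftrightarrow>
     (\<exists>p'. r = Seq p' q \<and> acp_step \<gamma> p b p') \<or> (acp_final p \<and> acp_step \<gamma> q b r)"
  "acp_step \<gamma> (Star p) b r \<longleftrightarrow> (\<exists>p'. r = Seq p' (Star p) \<and> acp_step \<gamma> p b p')"
  "acp_step \<gamma> (Par p q) b r \<longleftrightarrow>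
     (\<exists>p'. r = Par p' q \<and> acp_step \<gamma> p b p') \<or> (\<exists>q'. r = Par p q' \<and> acp_step \<gamma> q b q') \<or>
     (\<exists>p' q' c d. r = Par p' q' \<and> acp_step \<gamma> p c p' \<and> acp_step \<gamma> q d q' \<and> \<gamma> c d = Some b)"
  by (auto elim: acp_step.cases intro: acp_step.intros)

lemma pa_final_simps [simp]:
  "pa_final (Alt p q) \<longleftrightarrow> pa_final p \<or> pa_final q"
  "pa_final (Seq p q) \<longleftrightarrow> pa_final p \<and> pa_final q"
  "pa_final (Par p q) \<longleftrightarrow> pa_final p \<and> pa_final q"
  "pa_final (Star p)"
  by (auto elim: pa_final.cases intro: pa_final.intros)

lemma pa_step_simps [simp]:
  "\<not> pa_step Zero b r"
  "\<not> pa_step One b r"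
  "\<not> pa_step (Encap H p) b r"
  "pa_step (Act a) b r \<longleftrightarrow> b = a \<and> r = One"
  "pa_step (Alt p q) b r \<longleftrightarrow> pa_step p b r \<or> pa_step q b r"
  "pa_step (Seq p q) b r \<longleftrightarrow>
     (\<exists>p'. r = Seq p' q \<and> pa_step p b p') \<or> (pa_final p \<and> pa_step q b r)"
  "pa_step (Star p) b r \<longleftrightarrow> (\<exists>p'. r = Seq p' (Star p) \<and> pa_step p b p')"
  "pa_step (Par p q) b r \<longleftrightarrow>
     (\<exists>p'. r = Par p' q \<and> pa_step p b p') \<or> (\<exists>q'. r = Par p q' \<and> pa_step q b q')"
  by (auto elim: pa_step.cases intro: pa_step.intros)

section \<open>Derivatives reached in at least one step\<close>

inductive pa_reach :: "'a exp \<Rightarrow> 'a exp \<Rightarrow> bool" where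
  base: "pa_step p b q \<Longrightarrow> pa_reach p q"
| step: "pa_reach p q \<Longrightarrow> pa_step q b r \<Longrightarrow> pa_reach p r"

lemma pa_reach_imp_step: "pa_reach p s \<Longrightarrow> \<exists>b q. pa_step p b q"
  by (induction rule: pa_reach.induct) auto

lemma pa_reach_AltD: "pa_reach (Alt p q) s \<Longrightarrow> pa_reach p s \<or> pa_reach q s"
  by (induction "Alt p q" s rule: pa_reach.induct) (auto intro: pa_reach.intros)

lemma pa_reach_ActD: "pa_reach (Act a) s \<Longrightarrow> s = One"
  by (induction "Act a" s rule: pa_reach.induct) auto

lemma pa_reach_SeqD:
  "pa_reach (Seq p q) s \<Longrightarrow> (\<exists>r. s = Seq r q \<and> pa_reach p r) \<or> pa_reach q s"
  by (induction "Seq p q" s rule: pa_reach.induct) (auto, (blast intro: pa_reach.intros)+)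

text \<open>The step of \<open>p\<close> is recorded because it keeps the final expression
  \<open>Star p\<close> from being terminated.\<close>

lemma pa_reach_StarD: "pa_reach (Star p) s \<Longrightarrow> \<exists>r b p'. s = Seq r (Star p) \<and> pa_step p b p'"
  by (induction "Star p" s rule: pa_reach.induct) auto

lemma pa_reach_ParD:
  assumes "pa_reach (Par p q) s"
  shows "\<exists>r u. s = Par r u \<and> (r = p \<or> pa_reach p r) \<and> (u = q \<or> pa_reach q u)"
  using assms by (induction "Par p q" s rule: pa_reach.induct) (auto, (blast intro: pa_reach.intros)+)

section \<open>Bisimilarity with states of the disjoint union\<close>

definition pa_bisim :: "('a \<Rightarrow> 'a \<Rightarrow> 'a option) \<Rightarrow> 'a exp \<Rightarrow> 'a exp \<Rightarrow> bool" where
  "pa_bisim \<gamma> p x \<longleftrightarrow>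
     bisimilar PA (disjoint_union {\<gamma>. communication_function \<gamma>} ACP) p (\<gamma>, x)"

lemma pa_bisimE:
  assumes "pa_bisim \<gamma> p x"
  shows pa_bisim_encap_free: "encap_free p"
    and pa_bisim_communication: "communication_function \<gamma>"
    and pa_bisim_final: "pa_final p \<longleftrightarrow> acp_final x"
    and pa_bisim_forth: "pa_step p b p' \<Longrightarrow> \<exists>x'. acp_step \<gamma> x b x' \<and> pa_bisim \<gamma> p' x'"
    and pa_bisim_back: "acp_step \<gamma> x b x' \<Longrightarrow> \<exists>p'. pa_step p b p' \<and> pa_bisim \<gamma> p' x'"
proof -
  let ?U = "disjoint_union {\<gamma>. communication_function \<gamma>} ACP"
  obtain R where R: "bisimulation PA ?U R" "R p (\<gamma>, x)"
    using assms by (auto simp: pa_bisim_def bisimilar_def)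
  have sub: "R q (\<gamma>, y) \<Longrightarrow> pa_bisim \<gamma> q y" for q y
    using R by (auto simp: pa_bisim_def bisimilar_def)
  note * = R(1)[unfolded bisimulation_def, rule_format, OF R(2)]
  show "encap_free p" "communication_function \<gamma>" "pa_final p \<longleftrightarrow> acp_final x"
    using * by (auto simp: PA_def ACP_def disjoint_union_def)
  show "\<exists>x'. acp_step \<gamma> x b x' \<and> pa_bisim \<gamma> p' x'" if "pa_step p b p'"
    using * that sub by (fastforce simp: PA_def ACP_def disjoint_union_def)
  show "\<exists>p'. pa_step p b p' \<and> pa_bisim \<gamma> p' x'" if "acp_step \<gamma> x b x'"
    using * that sub by (fastforce simp: PA_def ACP_def disjoint_union_def)
qed

text \<open>Steps of the union keep its index, so a relation \<open>K\<close> at one fixed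
  \<open>\<gamma>\<close> suffices.\<close>

lemma pa_bisimI:
  assumes "K p x"
    and "\<And>p x. K p x \<Longrightarrow> encap_free p"
    and "communication_function \<gamma>"
    and "\<And>p x. K p x \<Longrightarrow> pa_final p \<longleftrightarrow> acp_final x"
    and "\<And>p x b p'. K p x \<Longrightarrow> pa_step p b p' \<Longrightarrow> \<exists>x'. acp_step \<gamma> x b x' \<and> K p' x'"
    and "\<And>p x b x'. K p x \<Longrightarrow> acp_step \<gamma> x b x' \<Longrightarrow> \<exists>p'. pa_step p b p' \<and> K p' x'"
  shows "pa_bisim \<gamma> p x"
  unfolding pa_bisim_def bisimilar_def
  using assms
  by (intro exI[of _ "\<lambda>p (\<delta>, x). \<delta> = \<gamma> \<and> K p x"])
     (auto simp: bisimulation_def PA_def ACP_def disjoint_union_def)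

lemma pa_bisim_None:
  assumes "encap_free p"
  shows "pa_bisim (\<lambda>_ _. None) p p"
proof (rule pa_bisimI[where K = "\<lambda>p x. x = p \<and> encap_free p"])
qed (use assms in \<open>auto simp: communication_function_None pa_final_iff pa_step_iff[symmetric]
       intro: pa_step_encap_free\<close>)

text \<open>The context \<open>f\<close> neither adds nor blocks steps or termination, so composing
  bisimilarity with \<open>f\<close> again gives a bisimulation.\<close>

lemma pa_bisim_strip:
  assumes "pa_bisim \<gamma> (f r) x"
    and step: "\<And>r b t. pa_step (f r) b t \<longleftrightarrow> (\<exists>r'. t = f r' \<and> pa_step r b r')"
    and final: "\<And>r. pa_final (f r) \<longleftrightarrow> pa_final r"
    and free: "\<And>r. encap_free (f r) \<Longrightarrow> encap_free r"
  shows "pa_bisim \<gamma> r x"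
proof (rule pa_bisimI[where K = "\<lambda>r x. pa_bisim \<gamma> (f r) x"])
  show "\<exists>x'. acp_step \<gamma> x b x' \<and> pa_bisim \<gamma> (f r') x'"
    if "pa_bisim \<gamma> (f r) x" "pa_step r b r'" for r x b r'
    using pa_bisim_forth[OF that(1)] that(2) step by blast
  show "\<exists>r'. pa_step r b r' \<and> pa_bisim \<gamma> (f r') x'"
    if "pa_bisim \<gamma> (f r) x" "acp_step \<gamma> x b x'" for r x b x'
    using pa_bisim_back[OF that] by (auto simp: step)
  show "pa_final r \<longleftrightarrow> acp_final x" if "pa_bisim \<gamma> (f r) x" for r x
    using pa_bisim_final[OF that] final by simp
qed (use assms(1) free in \<open>auto dest: pa_bisim_encap_free pa_bisim_communication\<close>)

definition terminated :: "'a exp \<Rightarrow> bool" where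
  "terminated p \<longleftrightarrow> pa_final p \<and> (\<forall>b p'. \<not> pa_step p b p')"

lemma pa_bisim_strip_terminated:
  assumes "terminated q"
  shows "pa_bisim \<gamma> (Seq r q) x \<Longrightarrow> pa_bisim \<gamma> r x"
    and "pa_bisim \<gamma> (Par r q) x \<Longrightarrow> pa_bisim \<gamma> r x"
    and "pa_bisim \<gamma> (Par q r) x \<Longrightarrow> pa_bisim \<gamma> r x"
  using assms
  by (auto simp: terminated_def elim!: pa_bisim_strip[of _ "\<lambda>r. Seq r q"]
      pa_bisim_strip[of _ "\<lambda>r. Par r q"] pa_bisim_strip[of _ "\<lambda>r. Par q r"])

text \<open>
  The loops start in \<open>1\<cdot>(a\<cdot>a)\<^sup>*\<cdot>a\<close> rather than \<open>(a\<cdot>a)\<^sup>*\<cdot>a\<close>, so that they return to exactly the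
  same expression.
\<close>

definition stateS :: "'a \<Rightarrow> 'a exp" where
  "stateS a = Seq (Seq One (Star (Seq (Act a) (Act a)))) (Act a)"

definition stateM :: "'a \<Rightarrow> 'a exp" where
  "stateM a = Seq (Seq (Seq One (Act a)) (Star (Seq (Act a) (Act a)))) (Act a)"

lemma stateS_M [simp]:
  "acp_step \<gamma> (stateS a) b r \<longleftrightarrow> b = a \<and> (r = stateM a \<or> r = One)"
  "acp_step \<gamma> (stateM a) b r \<longleftrightarrow> b = a \<and> r = stateS a"
  "\<not> acp_final (stateS a)"
  "\<not> acp_final (stateM a)"
  by (auto simp: stateS_def stateM_def)

lemma self_comm_simp [simp]: "self_comm a b c = Some d \<longleftrightarrow> b = a \<and> c = a \<and> d = a"
  by (auto simp: self_comm_def)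

section \<open>Moves of the separating process\<close>

definition stateX :: "'a \<Rightarrow> 'a exp" where
  "stateX a = Par (stateS a) (Alt (Act a) One)"

definition stateY :: "'a \<Rightarrow> 'a exp" where
  "stateY a = Par (stateM a) (Alt (Act a) One)"

lemma terminated_if_bisim: "pa_bisim \<gamma> p (Par One One) \<Longrightarrow> terminated p"
  using pa_bisim_final pa_bisim_forth by (fastforce simp: terminated_def)

lemma stateX_elims:
  assumes "pa_bisim (self_comm a) p (stateX a)"
  obtains e t y where "\<not> pa_final p"
    "pa_step p a e" "terminated e"
    "pa_step p a t" "pa_final t" "\<not> terminated t"
    "pa_step p a y" "pa_bisim (self_comm a) y (stateY a)"
proof -
  let ?\<gamma> = "self_comm a"
  \<comment> \<open>These are the communication, the exit of \<open>stateS\<close> alone, and the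
    first half of its loop.\<close>
  have "acp_step ?\<gamma> (stateX a) a (Par One One)"
    "acp_step ?\<gamma> (stateX a) a (Par One (Alt (Act a) One))"
    "acp_step ?\<gamma> (stateX a) a (stateY a)"
    by (auto simp: stateX_def stateY_def)
  then obtain e t y where
    e: "pa_step p a e" "pa_bisim ?\<gamma> e (Par One One)" and
    t: "pa_step p a t" "pa_bisim ?\<gamma> t (Par One (Alt (Act a) One))" and
    y: "pa_step p a y" "pa_bisim ?\<gamma> y (stateY a)"
    using pa_bisim_back[OF assms] by meson
  have "\<not> pa_final p"
    using pa_bisim_final[OF assms] by (simp add: stateX_def)
  moreover have "pa_final t"
    using pa_bisim_final[OF t(2)] by simp
  moreover have "\<not> terminated t"
    using pa_bisim_back[OF t(2), of a "Par One One"] by (auto simp: terminated_def)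
  ultimately show thesis
    using that e t(1) y terminated_if_bisim by blast
qed

lemma stateY_elims:
  assumes "pa_bisim (self_comm a) p (stateY a)"
  obtains x m where "pa_step p a x" "pa_bisim (self_comm a) x (stateX a)"
    "pa_step p a m" "pa_bisim (self_comm a) m (Par (stateM a) One)"
  using pa_bisim_back[OF assms, of a "stateX a"] pa_bisim_back[OF assms, of a "Par (stateM a) One"]
  by (auto simp: stateX_def stateY_def)

lemma stateY_step_not_final:
  assumes "pa_bisim (self_comm a) p (stateY a)" "pa_step p b p'"
  shows "\<not> pa_final p'"
  using pa_bisim_forth[OF assms] by (auto simp: stateY_def dest!: pa_bisim_final)

lemma stateM_step:
  assumes "pa_bisim (self_comm a) p (Par (stateM a) One)" "pa_step p b p'"
  shows "pa_bisim (self_comm a) p' (Par (stateS a) One)"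
  using pa_bisim_forth[OF assms] by auto

lemma stateS_step_final:
  assumes "pa_bisim (self_comm a) p (Par (stateS a) One)" "pa_step p b p'" "pa_final p'"
  shows "terminated p'"
  using pa_bisim_forth[OF assms(1,2)] assms(3)
  by (auto dest: pa_bisim_final terminated_if_bisim)

text \<open>
  Termination of the loop is only possible through a final state of \<open>r\<close>, but there the
  transition of \<open>q\<close> to \<open>t\<close> is enabled.
\<close>

lemma Seq_not_bisim_stateM:
  assumes "\<not> pa_final q" "pa_step q b t" "pa_final t" "\<not> terminated t"
  shows "\<not> pa_bisim (self_comm a) (Seq r q) (Par (stateM a) One)"
proof
  let ?\<gamma> = "self_comm a"
  assume M: "pa_bisim ?\<gamma> (Seq r q) (Par (stateM a) One)"
  \<comment> \<open>Otherwise \<open>t\<close> would be bisimilar to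
    \<open>Par (stateS a) One\<close>, which is not final.\<close>
  have "\<not> pa_final r"
    using stateM_step[OF M, of b t] pa_bisim_final assms by fastforce
  then obtain r1 where S: "pa_bisim ?\<gamma> (Seq r1 q) (Par (stateS a) One)"
    using pa_bisim_back[OF M, of a "Par (stateS a) One"] by auto
  \<comment> \<open>Otherwise the final successor \<open>t\<close> would have to be
    terminated.\<close>
  have "\<not> pa_final r1"
    using stateS_step_final[OF S, of b t] assms by auto
  then obtain r2 where "pa_bisim ?\<gamma> (Seq r2 q) (Par One One)"
    using pa_bisim_back[OF S, of a "Par One One"] by auto
  then show False
    using pa_bisim_final assms(1) by fastforce
qed

text \<open>The loop through \<open>stateY\<close> turns bisimilarity of \<open>p\<close> itself
  into a statement about states reached from \<open>p\<close>.\<close>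

lemma stateX_reaches_itself:
  assumes "pa_bisim (self_comm a) p (stateX a)"
  obtains p' where "pa_reach p p'" "pa_bisim (self_comm a) p' (stateX a)"
  using assms by (meson stateX_elims stateY_elims pa_reach.intros)

lemma not_pa_reach_stateX:
  "pa_reach p s \<Longrightarrow> \<not> pa_bisim (self_comm a) s (stateX a)"
proof (induction p arbitrary: s)
  case (Act b)
  then show ?case
    using pa_reach_ActD by (fastforce elim: stateX_elims)
next
  case (Alt p q)
  then show ?case using pa_reach_AltD by blast
next
  case (Star p)
  then obtain r b p' where s: "s = Seq r (Star p)" "pa_step p b p'"
    using pa_reach_StarD by blast
  show ?case
  proof
    assume "pa_bisim (self_comm a) s (stateX a)"
    then obtain e where "pa_step s a e" "terminated e"
      by (rule stateX_elims)
    \<comment> \<open>Each successor of \<open>s\<close> is some \<open>Seq r1 (Star p)\<close>: if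
      it is final, it can also start a new iteration.\<close>
    with s show False by (auto simp: terminated_def)
  qed
next
  case (Par p q)
  let ?X = "\<lambda>s. pa_bisim (self_comm a) s (stateX a)"
  \<comment> \<open>The induction hypotheses concern at least one step; the loop of
    \<open>stateX\<close> extends them to \<open>p\<close> and \<open>q\<close> themselves.\<close>
  have no: "\<not> ?X r" if "r = p \<or> pa_reach p r \<or> r = q \<or> pa_reach q r" for r
    using that Par.IH by (metis stateX_reaches_itself)
  obtain r u where s: "s = Par r u" "r = p \<or> pa_reach p r" "u = q \<or> pa_reach q u"
    using pa_reach_ParD[OF Par.prems] by blast
  show ?case
  proof
    assume X: "?X s"
    then obtain e where "pa_step s a e" "terminated e"
      by (rule stateX_elims)
    \<comment> \<open>The component that does not move into \<open>e\<close> is already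
      terminated.\<close>
    then have "terminated r \<or> terminated u"
      by (auto simp: s(1) terminated_def)
    then have "?X u \<or> ?X r"
      using X pa_bisim_strip_terminated s(1) by blast
    then show False using no s by blast
  qed
next
  case (Seq p q)
  let ?\<gamma> = "self_comm a"
  show ?case
  proof
    assume X: "pa_bisim ?\<gamma> s (stateX a)"
    then obtain r where s: "s = Seq r q" "pa_reach p r"
      using pa_reach_SeqD[OF Seq.prems] Seq.IH(2) by blast
    obtain e t y where *: "\<not> pa_final s" "pa_step s a e" "terminated e"
      "pa_step s a t" "pa_final t" "\<not> terminated t"
      "pa_step s a y" and Y: "pa_bisim ?\<gamma> y (stateY a)"
      using X by (rule stateX_elims)
    show False
    proof (cases "pa_final q")
      case True
      \<comment> \<open>As \<open>r\<close> is not final, \<open>e\<close> is some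
        \<open>Seq r1 q\<close>; with \<open>r1\<close> final, any step of \<open>q\<close> would be
        enabled in \<open>e\<close>.\<close>
      with * s have "terminated q" by (auto simp: terminated_def)
      then show False
        using X s Seq.IH(1) pa_bisim_strip_terminated(1) by blast
    next
      case False
      \<comment> \<open>No \<open>Seq r1 q\<close> is final, so \<open>t\<close> must come from
        \<open>q\<close>.\<close>
      with * s have q: "pa_step q a t" by auto
      obtain x m where x: "pa_step y a x" "pa_bisim ?\<gamma> x (stateX a)"
        and m: "pa_step y a m" "pa_bisim ?\<gamma> m (Par (stateM a) One)"
        using Y by (rule stateY_elims)
      \<comment> \<open>Otherwise \<open>q\<close> would reach \<open>x\<close> in two
        steps.\<close>
      have "\<not> pa_step q a y"
        using x Seq.IH(2)[OF pa_reach.step[OF pa_reach.base]] by blast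
      then obtain r' where r': "y = Seq r' q"
        using *(7) s by auto
      with stateY_step_not_final[OF Y, of a t] q *(5) have "\<not> pa_final r'"
        by auto
      with m r' obtain r'' where "m = Seq r'' q" by auto
      then show False
        using Seq_not_bisim_stateM[OF False q *(5,6)] m(2) by blast
    qed
  qed
next
  case Zero
  then show ?case by (auto dest!: pa_reach_imp_step)
next
  case One
  then show ?case by (auto dest!: pa_reach_imp_step)
next
  case (Encap H p)
  from pa_reach_imp_step[OF Encap.prems] show ?case by simp
qed

theorem theorem35:
  "less_expressive (PA :: ('a exp, 'a) tss) (disjoint_union {\<gamma>. communication_function \<gamma>} ACP)"
proof -
  let ?U = "disjoint_union {\<gamma>. communication_function \<gamma>} ACP"
  \<comment> \<open>Any action would do; \<open>undefined\<close> names one, since types are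
    nonempty.\<close>
  let ?x = "(self_comm undefined, stateX undefined) :: ('a \<Rightarrow> 'a \<Rightarrow> 'a option) \<times> 'a exp"
  have states: "(\<gamma>, x) \<in> states ?U \<longleftrightarrow> communication_function \<gamma>"
    for \<gamma> and x :: "'a exp"
    by (simp add: disjoint_union_def ACP_def)
  have "\<exists>s2\<in>states ?U. bisimilar PA ?U s1 s2" if "s1 \<in> states PA" for s1 :: "'a exp"
  proof
    show "((\<lambda>_ _. None), s1) \<in> states ?U"
      by (simp add: states communication_function_None)
    show "bisimilar PA ?U s1 ((\<lambda>_ _. None), s1)"
      using pa_bisim_None[of s1] that by (simp add: pa_bisim_def PA_def)
  qed
  moreover have "?x \<in> states ?U"
    by (simp add: states communication_function_self_comm)
  moreover have "\<not> bisimilar PA ?U s1 ?x" for s1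
    unfolding pa_bisim_def[symmetric] by (blast elim: stateX_reaches_itself dest: not_pa_reach_stateX)
  ultimately show ?thesis
    unfolding less_expressive_def by blast
qed

end
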